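(* Define $\alpha'(k) = \min \{n\ge 0 : t(n) = k\}$. Then $\alpha'(k) = m(k) -1$ for all integers $k \geq 1$.
   Context: Let $(a(n))_{n\ge 0}$ be the Rudin-Shapiro sequence, defined by $a(0)=1$, $a(2n)=a(n)$, $a(2n+1)=(-1)^n a(n)$ for $n\ge 0$. Let $t(n)=\sum_{0\le i\le n}(-1)^i a(i)$. For $k\ge 0$, $m(k)$ denotes the integer obtained by reading the base-$2$ representation of $k$ as a base-$4$ numeral; i.e., if $k=\sum_i c_i 2^i$ with $c_i\in\{0,1\}$, then $m(k)=\sum_i c_i 4^i$. *)

theory Defs
  imports Main
begin

fun rudin_shapiro :: "nat \<Rightarrow> int" where
  "rudin_shapiro n =
     (if n = 0 then 1
      else if even n then rudin_shapiro (n div 2)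
      else (-1) ^ (n div 2) * rudin_shapiro (n div 2))"

declare rudin_shapiro.simps [simp del]

lemma rudin_shapiro_0: "rudin_shapiro 0 = 1"
  by (simp add: rudin_shapiro.simps)

lemma rudin_shapiro_even: "rudin_shapiro (2 * n) = rudin_shapiro n"
  by (cases "n = 0") (simp_all add: rudin_shapiro.simps [of "2 * n"])

lemma rudin_shapiro_odd: "rudin_shapiro (2 * n + 1) = (-1) ^ n * rudin_shapiro n"
  by (subst rudin_shapiro.simps) simp

definition rs_alternating_sum :: "nat \<Rightarrow> int" where
  "rs_alternating_sum n = (\<Sum>i\<le>n. (-1) ^ i * rudin_shapiro i)"

(* The binary digit c_i of k is 1 iff bit k i holds;
   the index set is finite by finite_bits below. *)
definition binary_as_base4 :: "nat \<Rightarrow> nat" where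
  "binary_as_base4 k = (\<Sum>i | bit k i. 4 ^ i)"

lemma finite_bits: "finite {i. bit (k :: nat) i}"
proof (rule finite_subset)
  show "{i. bit k i} \<subseteq> {..<k}"
  proof
    fix i assume "i \<in> {i. bit k i}"
    then have "k div 2 ^ i \<noteq> 0"
      by (auto simp: bit_iff_odd elim: oddE)
    then have "2 ^ i \<le> k"
      by (metis div_less not_le)
    then have "i < k"
      using less_exp [of i] by (rule order.strict_trans2 [rotated])
    then show "i \<in> {..<k}" by simp
  qed
qed simp

(* LEAST is unspecified when no n satisfies the equation, so attainment of the minimum
   has to be asserted separately wherever alpha' is used. *)
definition alpha' :: "int \<Rightarrow> nat" where
  "alpha' k = (LEAST n. rs_alternating_sum n = k)"

end

(* Writing T n for the sum of (-1)^i a(i) over i < n, the recursion of the sequence a gives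
   T (4 n) = T (4 n + 2) = 2 T n, while T (4 n + 1) and T (4 n + 3) differ from 2 T n by 1 or -1.
   Hence T (m k) = k by induction on the binary digits of k, the sequence being 1 at m k because
   m k never has two adjacent binary digits 1. Conversely, T n = k forces
   T (n div 4) to be k div 2, or k div 2 + 1 when k is odd, and n >= m k follows by induction on n. *)
theory Submission
  imports Defs
begin

section \<open>Reading binary digits in base 4\<close>

lemma binary_as_base4_0 [simp]: "binary_as_base4 0 = 0"
  by (simp add: binary_as_base4_def)

lemma sum_four_power_Suc_bits:
  "(\<Sum>i \<in> Suc ` {i. bit k i}. (4::nat) ^ i) = 4 * binary_as_base4 k"
  by (simp add: sum.reindex binary_as_base4_def sum_distrib_left)

lemma binary_as_base4_even: "binary_as_base4 (2 * k) = 4 * binary_as_base4 k"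
proof -
  have "{i. bit (2 * k) i} = Suc ` {i. bit k i}"
    by (auto simp: bit_double_iff image_iff gr0_conv_Suc dest: bit_imp_possible_bit)
  then show ?thesis
    by (simp add: binary_as_base4_def [of "2 * k"] sum_four_power_Suc_bits)
qed

lemma binary_as_base4_odd: "binary_as_base4 (2 * k + 1) = 4 * binary_as_base4 k + 1"
proof -
  have "bit (2 * k + 1) i \<longleftrightarrow> i = 0 \<or> i \<in> Suc ` {i. bit k i}" for i
    by (cases i) (auto simp: bit_0 bit_Suc)
  then have "{i. bit (2 * k + 1) i} = insert 0 (Suc ` {i. bit k i})"
    by blast
  then show ?thesis
    by (simp add: binary_as_base4_def [of "Suc (2 * k)"] finite_bits sum_four_power_Suc_bits)
qed

text \<open>Serves the odd case of \<open>binary_as_base4_le\<close>, where the partial sum at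
  \<open>q\<close> may be one larger than \<open>k div 2\<close>. When \<open>k = 2 * j + 1\<close>,
  the carry is absorbed by the induction hypothesis for \<open>j\<close>, since x < y gives 4 x + 1
  < 4 y.\<close>

lemma binary_as_base4_less_Suc: "binary_as_base4 k < binary_as_base4 (Suc k)"
proof (induction k rule: less_induct)
  case (less k)
  show ?case
  proof (cases "even k")
    case True
    then obtain j where "k = 2 * j" ..
    then show ?thesis
      using binary_as_base4_even [of j] binary_as_base4_odd [of j] by simp
  next
    case False
    then obtain j where j: "k = 2 * j + 1" ..
    then have "binary_as_base4 j < binary_as_base4 (Suc j)"
      using less by simp
    then show ?thesis
      using j binary_as_base4_odd [of j] binary_as_base4_even [of "Suc j"] by simp
  qed
qed

section \<open>Partial sums of the Rudin-Shapiro sequence\<close>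

lemma rudin_shapiro_cases: "rudin_shapiro n = 1 \<or> rudin_shapiro n = -1"
proof (induction n rule: less_induct)
  case (less n)
  show ?case
  proof (cases "n = 0")
    case True
    then show ?thesis by (simp add: rudin_shapiro_0)
  next
    case False
    then have "rudin_shapiro (n div 2) = 1 \<or> rudin_shapiro (n div 2) = -1"
      by (intro less) simp
    then show ?thesis
      using False by (cases "even (n div 2)") (auto simp: rudin_shapiro.simps [of n])
  qed
qed

lemma rudin_shapiro_4:
  "rudin_shapiro (4 * n) = rudin_shapiro n"
  "rudin_shapiro (4 * n + 1) = rudin_shapiro n"
  "rudin_shapiro (4 * n + 2) = (-1) ^ n * rudin_shapiro n"
  using rudin_shapiro_even [of n] rudin_shapiro_even [of "2 * n"] rudin_shapiro_odd [of "2 * n"]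
    rudin_shapiro_even [of "2 * n + 1"] rudin_shapiro_odd [of n]
  by simp_all

lemma rudin_shapiro_binary_as_base4: "rudin_shapiro (binary_as_base4 k) = 1"
proof (induction k rule: less_induct)
  case (less k)
  show ?case
  proof (cases "k = 0")
    case True
    then show ?thesis by (simp add: rudin_shapiro_0)
  next
    case False
    then have "rudin_shapiro (binary_as_base4 (k div 2)) = 1"
      by (intro less) simp
    moreover have "k = 2 * (k div 2) \<or> k = 2 * (k div 2) + 1"
      by presburger
    \<comment> \<open>Appending a base-4 digit 0 or 1 leaves the value of the sequence
      unchanged.\<close>
    ultimately show ?thesis
      by (metis binary_as_base4_even binary_as_base4_odd rudin_shapiro_4(1,2))
  qed
qed

text \<open>Auxiliary: doubling the range turns the alternating sum into a combination of both sums,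
  so a closed recursion needs the plain sum too.\<close>

definition rs_sum :: "nat \<Rightarrow> int" where
  "rs_sum n = (\<Sum>i<n. rudin_shapiro i)"

(* Excludes the last index, unlike rs_alternating_sum. *)
definition rs_alt_sum :: "nat \<Rightarrow> int" where
  "rs_alt_sum n = (\<Sum>i<n. (-1) ^ i * rudin_shapiro i)"

lemma rs_alternating_sum_eq: "rs_alternating_sum n = rs_alt_sum (Suc n)"
  by (simp add: rs_alternating_sum_def rs_alt_sum_def lessThan_Suc_atMost)

text \<open>Pair the indices 2 i and 2 i + 1: their values are a(i) and (-1)^i a(i).\<close>

lemma rs_sum_double: "rs_sum (2 * n) = rs_sum n + rs_alt_sum n"
  using rudin_shapiro_even rudin_shapiro_odd
  by (induction n) (auto simp: rs_sum_def rs_alt_sum_def)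

lemma rs_alt_sum_double: "rs_alt_sum (2 * n) = rs_sum n - rs_alt_sum n"
  using rudin_shapiro_even rudin_shapiro_odd
  by (induction n) (auto simp: rs_sum_def rs_alt_sum_def)

text \<open>Doubling maps the pair (S, T) of plain and alternating sums to (S + T, S - T). Doing
  this twice multiplies by 2, so S drops out of the recursion at 4 n; the other residues add single
  terms.\<close>

lemma rs_alt_sum_4:
  "rs_alt_sum (4 * n) = 2 * rs_alt_sum n"
  "rs_alt_sum (4 * n + 1) = 2 * rs_alt_sum n + rudin_shapiro n"
  "rs_alt_sum (4 * n + 2) = 2 * rs_alt_sum n"
  "rs_alt_sum (4 * n + 3) = 2 * rs_alt_sum n + (-1) ^ n * rudin_shapiro n"
proof -
  have Suc: "rs_alt_sum (Suc j) = rs_alt_sum j + (-1) ^ j * rudin_shapiro j" for j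
    by (simp add: rs_alt_sum_def)
  show 0: "rs_alt_sum (4 * n) = 2 * rs_alt_sum n"
    using rs_alt_sum_double [of "2 * n"] by (simp add: rs_sum_double rs_alt_sum_double)
  show 1: "rs_alt_sum (4 * n + 1) = 2 * rs_alt_sum n + rudin_shapiro n"
    using Suc [of "4 * n"] 0 by (simp add: rudin_shapiro_4)
  \<comment> \<open>The terms at 4 n and 4 n + 1 cancel: equal values of the sequence, opposite
    signs.\<close>
  show 2: "rs_alt_sum (4 * n + 2) = 2 * rs_alt_sum n"
    using Suc [of "4 * n + 1"] 1 rudin_shapiro_4(2) [of n] by simp
  show "rs_alt_sum (4 * n + 3) = 2 * rs_alt_sum n + (-1) ^ n * rudin_shapiro n"
    using Suc [of "4 * n + 2"] 2 rudin_shapiro_4(3) [of n]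
    by (simp add: numeral_3_eq_3)
qed

lemma rs_alt_sum_binary_as_base4: "rs_alt_sum (binary_as_base4 k) = int k"
proof (induction k rule: less_induct)
  case (less k)
  show ?case
  proof (cases "k = 0")
    case True
    then show ?thesis by (simp add: rs_alt_sum_def)
  next
    case False
    define j where "j = k div 2"
    have IH: "rs_alt_sum (binary_as_base4 j) = int j"
      using False by (intro less) (simp add: j_def)
    have "k = 2 * j \<or> k = 2 * j + 1"
      unfolding j_def by presburger
    then show ?thesis
      using IH rs_alt_sum_4(1,2) [of "binary_as_base4 j"]
        rudin_shapiro_binary_as_base4 [of j] binary_as_base4_even [of j] binary_as_base4_odd [of j]
      by auto
  qed
qed

lemma binary_as_base4_le: "rs_alt_sum n = int k \<Longrightarrow> binary_as_base4 k \<le> n"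
proof (induction n arbitrary: k rule: less_induct)
  case (less n)
  show ?case
  proof (cases "n = 0")
    case True
    then show ?thesis using less.prems by (simp add: rs_alt_sum_def)
  next
    case False
    define q where "q = n div 4"
    have IH: "binary_as_base4 j \<le> q" if "rs_alt_sum q = int j" for j
      using False that by (intro less.IH) (simp_all add: q_def)
    have sign: "(-1) ^ q * rudin_shapiro q = 1 \<or> (-1) ^ q * rudin_shapiro q = -1"
      using rudin_shapiro_cases [of q] by (cases "even q") auto
    have n: "n = 4 * q \<or> n = 4 * q + 1 \<or> n = 4 * q + 2 \<or> n = 4 * q + 3"
      unfolding q_def by presburger
    \<comment> \<open>The parity of the residue of \<open>n\<close> mod 4 is that of the partial
      sum, hence of \<open>k\<close>; beyond that only a lower bound on \<open>n\<close>
      matters.\<close>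
    then consider (even) "rs_alt_sum n = 2 * rs_alt_sum q" "4 * q \<le> n"
      | (odd) "rs_alt_sum n = 2 * rs_alt_sum q + 1 \<or> rs_alt_sum n = 2 * rs_alt_sum q - 1"
          "4 * q + 1 \<le> n"
      using rs_alt_sum_4 [of q] rudin_shapiro_cases [of q] sign by auto
    then show ?thesis
    proof cases
      case even
      then have "rs_alt_sum q = int (k div 2)" and "k = 2 * (k div 2)"
        using less.prems by presburger+
      then show ?thesis
        using IH [of "k div 2"] binary_as_base4_even [of "k div 2"] even(2) by simp
    next
      case odd
      \<comment> \<open>The sign of the last term is unknown, so both neighbours (k - 1) / 2 and (k
        + 1) / 2 are possible.\<close>
      then have "rs_alt_sum q = int (k div 2) \<or> rs_alt_sum q = int (Suc (k div 2))"
        and k: "k = 2 * (k div 2) + 1"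
        using less.prems by presburger+
      \<comment> \<open>In the second case the induction hypothesis bounds \<open>q\<close> by the
        larger value at \<open>Suc (k div 2)\<close>.\<close>
      then have "binary_as_base4 (k div 2) \<le> q"
        using IH binary_as_base4_less_Suc [of "k div 2"] by (metis less_imp_le order.trans)
      then show ?thesis
        using binary_as_base4_odd [of "k div 2"] k odd(2) by simp
    qed
  qed
qed

theorem theorem30:
  fixes k :: nat
  assumes "k \<ge> 1"
  shows "(\<exists>n. rs_alternating_sum n = int k) \<and> int (alpha' (int k)) = int (binary_as_base4 k) - 1"
proof -
  \<comment> \<open>Needed for a predecessor \<open>n\<close> to exist. As
    \<open>rs_alternating_sum\<close> includes its last index and \<open>rs_alt_sum\<close> does
    not, this predecessor is the minimiser, whence the -1.\<close>
  have "binary_as_base4 k \<noteq> 0"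
  proof
    assume "binary_as_base4 k = 0"
    then show False
      using rs_alt_sum_binary_as_base4 [of k] assms by (simp add: rs_alt_sum_def)
  qed
  then obtain n where n: "binary_as_base4 k = Suc n"
    using not0_implies_Suc by blast
  then have attained: "rs_alternating_sum n = int k"
    using rs_alt_sum_binary_as_base4 [of k] by (simp add: rs_alternating_sum_eq)
  have "n \<le> j" if "rs_alternating_sum j = int k" for j
    using binary_as_base4_le [of "Suc j" k] that n by (simp add: rs_alternating_sum_eq)
  then have "alpha' (int k) = n"
    unfolding alpha'_def using attained by (intro Least_equality)
  then show ?thesis
    using attained n by auto
qed

end
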